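(* For every integer $n\ge 1$, \[ \frac{1}{2}\cdot n^{1/7}\le L_3(n)\le \left\lceil n^{1/7}\right\rceil,\qquad \frac{1}{4}\cdot n^{1/15}\le L_4(n)\le \left\lceil n^{1/15}\right\rceil .\]
   Context: An ordered hypergraph is a hypergraph whose vertex set is equipped with a total order. An (ordered) $r$-matching is an ordered hypergraph in which every edge has exactly $r$ vertices and every vertex is contained in exactly one edge; its size is its number of edges. An $r$-pattern is an $r$-matching of size $2$ on the vertex set $\{1,\dots,2r\}$. For an $r$-pattern $P$, an $r$-matching is a $P$-clique if every pair of its edges (with the induced ordering on their $2r$ vertices) is order-isomorphic to $P$. For an $r$-matching $M$, $L_P(M)$ is the size of the largest $P$-clique contained in $M$ (formed by a subset of the edges of $M$), and $L(M)=\max_P L_P(M)$, the maximum being over all $r$-patterns $P$. $L_r(n)$ is the minimum value of $L(M)$ over all ordered $r$-matchings $M$ of size $n$. *)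

theory Defs
  imports Complex_Main
begin

text \<open>A hypergraph is a pair of its vertex set and its edge set; the total order on the
  vertices is that of the ambient linearly ordered type.\<close>

type_synonym 'a ordered_hypergraph = "'a set \<times> 'a set set"

definition verts :: "'a ordered_hypergraph \<Rightarrow> 'a set" where
  "verts H = fst H"

definition edges :: "'a ordered_hypergraph \<Rightarrow> 'a set set" where
  "edges H = snd H"

definition hypergraph :: "'a ordered_hypergraph \<Rightarrow> bool" where
  "hypergraph H \<longleftrightarrow> finite (verts H) \<and> (\<forall>e\<in>edges H. e \<subseteq> verts H)"

definition matching :: "nat \<Rightarrow> 'a ordered_hypergraph \<Rightarrow> bool" where
  "matching r M \<longleftrightarrow> hypergraph M \<and> (\<forall>e\<in>edges M. card e = r) \<and>
     (\<forall>v\<in>verts M. \<exists>!e. e \<in> edges M \<and> v \<in> e)"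

definition msize :: "'a ordered_hypergraph \<Rightarrow> nat" where
  "msize M = card (edges M)"

definition order_isomorphic ::
    "'a::linorder ordered_hypergraph \<Rightarrow> 'b::linorder ordered_hypergraph \<Rightarrow> bool" where
  "order_isomorphic G H \<longleftrightarrow>
     (\<exists>f. bij_betw f (verts G) (verts H) \<and> strict_mono_on (verts G) f \<and>
          (\<lambda>e. f ` e) ` edges G = edges H)"

definition is_pattern :: "nat \<Rightarrow> nat ordered_hypergraph \<Rightarrow> bool" where
  "is_pattern r P \<longleftrightarrow> matching r P \<and> verts P = {1..2 * r} \<and> msize P = 2"

text \<open>The empty matching and a single edge are cliques for every pattern.\<close>

definition is_clique :: "nat ordered_hypergraph \<Rightarrow> 'a::linorder ordered_hypergraph \<Rightarrow> bool" where
  "is_clique P M \<longleftrightarrow>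
     (\<forall>e\<in>edges M. \<forall>f\<in>edges M. e \<noteq> f \<longrightarrow> order_isomorphic (e \<union> f, {e, f}) P)"

definition L_pattern :: "nat ordered_hypergraph \<Rightarrow> 'a::linorder ordered_hypergraph \<Rightarrow> nat" where
  "L_pattern P M = Max {msize (\<Union>E, E) | E. E \<subseteq> edges M \<and> is_clique P (\<Union>E, E)}"

definition L_matching :: "nat \<Rightarrow> 'a::linorder ordered_hypergraph \<Rightarrow> nat" where
  "L_matching r M = Max {L_pattern P M | P. is_pattern r P}"

text \<open>Every finite ordered matching is order-isomorphic to one whose vertices are natural
  numbers in their usual order, so the minimum may be taken over those. \<open>Inf\<close> of a nonempty
  set of natural numbers is its least element.\<close>

definition L :: "nat \<Rightarrow> nat \<Rightarrow> nat" where
  "L r n = Inf {L_matching r M | M :: nat ordered_hypergraph. matching r M \<and> msize M = n}"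

end

theory Submission
  imports Defs
begin

text \<open>Both bounds hold for every \<open>r > 0\<close>: if \<open>m\<close> is the size of the largest clique in an
  \<open>r\<close>-matching with \<open>n\<close> edges, then \<open>n \<le> 2\<^bsup>r-1\<^esup> (r-1)! m\<^bsup>2\<^sup>r-1\<^esup>\<close>, and for \<open>n \<le> m\<^bsup>2\<^sup>r-1\<^esup>\<close> some
  \<open>r\<close>-matching with \<open>n\<close> edges has no clique larger than \<open>m\<close>. The theorem is the case
  \<open>r = 3, 4\<close>.

  Lower bound on the clique size. Call a family of edges cut at a gap \<open>g\<close> if one point separates
  the first \<open>g\<close> vertices of every edge from the remaining ones. Cuts at a set \<open>G\<close> of gaps divide
  the vertices of each edge into \<open>|G| + 1\<close> blocks, each confined to its own region. Suppose that,
  for two edges, the spans of corresponding blocks are all disjoint. The pattern of the two edges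
  is then determined by the order of the spans in each block, and if the edge that comes first in
  the first block is listed first, a set of at most \<open>|G|\<close> reversed blocks describes it.
  Each of these \<open>2\<^bsup>|G|\<^esup>\<close> relations is a partial order whose chains are cliques, so its chains have at most
  \<open>m\<close> elements. Applying Mirsky's theorem to each of them retains a fraction
  \<open>m\<^bsup>-2\<^bsup>|G|\<^esup>\<^esup>\<close> of the edges, among which any two have intersecting spans in some block. If two
  intervals intersect, one of them contains the left end of the other. Hence, by double
  counting, the left end of one block of one edge \<open>e\<close> lies inside the corresponding blocks of a
  constant fraction of the edges, and it cuts those edges at a new gap; there are
  \<open>r - 1 - |G|\<close> choices for the gap, so the loss is a factor
  \<open>2 (r - 1 - |G|)\<close>. Starting from no cut and continuing until every block is a single vertex gives
  the exponent \<open>1 + 2 + \<dots> + 2\<^bsup>r-1\<^esup> = 2\<^sup>r - 1\<close> and the constant \<open>2\<^bsup>r-1\<^esup> (r-1)!\<close>. The induction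
  is \<open>card_le_of_cut\<close>.

  Upper bound. For \<open>G = {1..k}\<close> with \<open>k < r\<close> there are \<open>2\<^sup>k\<close> such patterns, hence \<open>2\<^sup>r - 1\<close> in all,
  and these can be nested: edges are words with one letter below \<open>m\<close> for each pattern, the patterns being
  ordered by \<open>k\<close>, and vertices are ordered lexicographically in such a way that two edges form the pattern of the
  first letter in which they differ. All pairs in a clique then first differ at the same letter,
  and that letter takes only \<open>m\<close> values. This is \<open>matching_without_large_clique\<close>.\<close>

section \<open>The vertices of an edge in increasing order\<close>

definition vtx :: "'a::linorder set \<Rightarrow> nat \<Rightarrow> 'a" where
  "vtx e i = sorted_list_of_set e ! i"

lemma vtx_less:
  assumes "card e = r" "i < j" "j < r"
  shows "vtx e i < vtx e j"
  using assms strict_sorted_list_of_set[of e] unfolding vtx_def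
  by (simp add: sorted_wrt_nth_less)

lemma vtx_le:
  assumes "card e = r" "i \<le> j" "j < r"
  shows "vtx e i \<le> vtx e j"
  using vtx_less[OF assms(1) _ assms(3), of i] assms(2) by (cases "i = j") auto

lemma vtx_less_iff:
  assumes "card e = r" "i < r" "j < r"
  shows "vtx e i < vtx e j \<longleftrightarrow> i < j"
  using assms vtx_less vtx_le by (metis leD leI)

lemma vtx_image:
  assumes "finite e" "card e = r"
  shows "vtx e ` {..<r} = e"
proof -
  have "vtx e ` {0..<length (sorted_list_of_set e)} = set (sorted_list_of_set e)"
    using nth_image[of "length (sorted_list_of_set e)" "sorted_list_of_set e"]
    by (simp add: vtx_def[abs_def])
  then show ?thesis using assms by (simp add: lessThan_atLeast0)
qed

lemma vtx_inj:
  assumes "card e = r"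
  shows "inj_on (vtx e) {..<r}"
  using vtx_less_iff[OF assms] by (intro inj_onI) (metis lessThan_iff linorder_less_linear less_irrefl)

lemma card_vtx_le:
  assumes "finite e" "card e = r"
  shows "card {y \<in> e. y \<le> x} = card {k. k < r \<and> vtx e k \<le> x}"
proof -
  have "{y \<in> e. y \<le> x} = vtx e ` {k. k < r \<and> vtx e k \<le> x}" (is "?L = ?R")
  proof
    show "?L \<subseteq> ?R" using vtx_image[OF assms] by force
    show "?R \<subseteq> ?L" using vtx_image[OF assms] by force
  qed
  then show ?thesis
    by (metis (no_types, lifting) card_image inj_on_subset[OF vtx_inj[OF assms(2)]] lessThan_iff mem_Collect_eq subsetI)
qed

lemma vtx_strict_mono_image:
  assumes "finite e" "card e = r" "strict_mono_on e \<phi>" "i < r"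
  shows "vtx (\<phi> ` e) i = \<phi> (vtx e i)"
proof -
  let ?xs = "sorted_list_of_set e"
  have "sorted_wrt (<) (map \<phi> ?xs)"
    unfolding sorted_wrt_map
    by (rule sorted_wrt_mono_rel[of ?xs "(<)"])
      (use assms in \<open>auto simp: strict_mono_on_def\<close>)
  moreover have "set (map \<phi> ?xs) = \<phi> ` e" using assms(1) by simp
  ultimately have "sorted_list_of_set (\<phi> ` e) = map \<phi> ?xs"
    using assms(1) by (metis finite_imageI sorted_list_of_set.idem_if_sorted_distinct strict_sorted_iff)
  then show ?thesis using assms unfolding vtx_def by simp
qed

lemma vtx_of_increasing:
  fixes a :: "nat \<Rightarrow> 'a::linorder"
  assumes "strict_mono_on {..<r} a" "i < r"
  shows "vtx (a ` {..<r}) i = a i"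
proof -
  have "vtx {..<r} i = i"
    using assms(2) unfolding vtx_def by (simp add: lessThan_atLeast0)
  then show ?thesis
    using vtx_strict_mono_image[of "{..<r}" r a i] assms by simp
qed

section \<open>Patterns as comparison matrices\<close>

text \<open>The matrix \<open>T\<close> records all comparisons between the vertices of two edges. For disjoint
  edges it carries the same information as the pattern of the ordered pair.\<close>

definition has_type :: "nat \<Rightarrow> (nat \<Rightarrow> nat \<Rightarrow> bool) \<Rightarrow> 'a::linorder set \<Rightarrow> 'a set \<Rightarrow> bool" where
  "has_type r T e f \<longleftrightarrow> (\<forall>i<r. \<forall>j<r. vtx e i < vtx f j \<longleftrightarrow> T i j)"

text \<open>The numbers listed are the ranks of the vertices of the two edges in their union: the
  vertex with index \<open>i\<close> of one edge is preceded by \<open>i\<close> vertices of that edge and by those vertices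
  of the other edge that the matrix says are smaller.\<close>

definition type_pattern :: "nat \<Rightarrow> (nat \<Rightarrow> nat \<Rightarrow> bool) \<Rightarrow> nat ordered_hypergraph" where
  "type_pattern r T = ({1..2 * r},
     {(\<lambda>i. Suc i + card {j. j < r \<and> \<not> T i j}) ` {..<r},
      (\<lambda>j. Suc j + card {i. i < r \<and> T i j}) ` {..<r}})"

text \<open>The isomorphism sends each vertex to its rank in the union of the two edges. Since the
  pattern depends on the matrix only, two pairs with the same matrix have the same pattern.\<close>

lemma pair_type_pattern:
  fixes e f :: "'a::linorder set"
  assumes "finite e" "finite f" "card e = r" "card f = r" "e \<inter> f = {}" "0 < r"
    and T: "has_type r T e f"
  shows "order_isomorphic (e \<union> f, {e, f}) (type_pattern r T)" (is ?iso)
    and "is_pattern r (type_pattern r T)" (is ?pat)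
proof -
  let ?V = "e \<union> f"
  define rank where "rank x = card {y \<in> ?V. y \<le> x}" for x
  have finV: "finite ?V" and cardV: "card ?V = 2 * r"
    using assms by (auto simp: card_Un_disjoint)
  have mono: "strict_mono_on ?V rank"
  proof (rule strict_mono_onI)
    fix x y assume xy: "x \<in> ?V" "y \<in> ?V" "x < y"
    then have "{z \<in> ?V. z \<le> x} \<subseteq> {z \<in> ?V. z \<le> y}" "y \<in> {z \<in> ?V. z \<le> y} - {z \<in> ?V. z \<le> x}"
      by auto
    then show "rank x < rank y" unfolding rank_def using finV by (intro psubset_card_mono) auto
  qed
  then have inj: "inj_on rank ?V" by (rule strict_mono_on_imp_inj_on)
  have "rank ` ?V \<subseteq> {1..2 * r}"
  proof
    fix v assume "v \<in> rank ` ?V"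
    then obtain x where x: "x \<in> ?V" "v = rank x" by blast
    have "rank x \<le> card ?V" unfolding rank_def by (rule card_mono[OF finV]) auto
    moreover have "0 < rank x" unfolding rank_def card_gt_0_iff using x finV by auto
    ultimately show "v \<in> {1..2 * r}" using x cardV by auto
  qed
  then have img: "rank ` ?V = {1..2 * r}"
    by (rule card_subset_eq[OF finite_atLeastAtMost]) (simp add: card_image[OF inj] cardV)
  have ve: "vtx e ` {..<r} = e" and vf: "vtx f ` {..<r} = f" using vtx_image assms(1-4) by blast+
  have neq: "vtx e i \<noteq> vtx f j" if "i < r" "j < r" for i j
    using ve vf assms(5) that by (metis disjoint_iff imageI lessThan_iff)
  have rank_split: "rank x = card {k. k < r \<and> vtx e k \<le> x} + card {k. k < r \<and> vtx f k \<le> x}" for x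
  proof -
    have "{y \<in> ?V. y \<le> x} = {y \<in> e. y \<le> x} \<union> {y \<in> f. y \<le> x}" by auto
    moreover have "{y \<in> e. y \<le> x} \<inter> {y \<in> f. y \<le> x} = {}" using assms(5) by auto
    ultimately show ?thesis
      unfolding rank_def using assms(1-4) by (simp add: card_Un_disjoint card_vtx_le)
  qed
  have own: "{k. k < r \<and> vtx a k \<le> vtx a i} = {..i}" if "card a = r" "i < r" for a :: "'a set" and i
    using vtx_less_iff[OF that(1,2)] that(2) by (auto simp: not_less[symmetric])
  have rank_e: "rank (vtx e i) = Suc i + card {j. j < r \<and> \<not> T i j}" if i: "i < r" for i
  proof -
    have "{k. k < r \<and> vtx f k \<le> vtx e i} = {j. j < r \<and> \<not> T i j}"
      using T i unfolding has_type_def by (auto simp: not_less[symmetric])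
    then show ?thesis unfolding rank_split own[OF assms(3) i] by simp
  qed
  have rank_f: "rank (vtx f j) = Suc j + card {i. i < r \<and> T i j}" if j: "j < r" for j
  proof -
    have "{k. k < r \<and> vtx e k \<le> vtx f j} = {i. i < r \<and> T i j}"
      using T j neq unfolding has_type_def by (auto simp: le_less)
    then show ?thesis unfolding rank_split own[OF assms(4) j] by simp
  qed
  have P: "type_pattern r T = ({1..2 * r}, {rank ` e, rank ` f})"
  proof -
    have "rank ` e = (\<lambda>i. Suc i + card {j. j < r \<and> \<not> T i j}) ` {..<r}"
      using rank_e by (subst ve[symmetric]) (auto simp: image_image)
    moreover have "rank ` f = (\<lambda>j. Suc j + card {i. i < r \<and> T i j}) ` {..<r}"
      using rank_f by (subst vf[symmetric]) (auto simp: image_image)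
    ultimately show ?thesis unfolding type_pattern_def by simp
  qed
  show ?iso unfolding order_isomorphic_def P verts_def edges_def
    by (rule exI[of _ rank]) (use mono inj img in \<open>auto simp: bij_betw_def\<close>)
  have disj: "rank ` e \<inter> rank ` f = {}"
    using inj_on_image_Int[OF inj, of e f] assms(5) by auto
  have "card (rank ` e) = r" "card (rank ` f) = r"
    using inj assms by (auto simp: card_image inj_on_Un)
  moreover have "rank ` e \<noteq> {}" using assms by auto
  then have "rank ` e \<noteq> rank ` f" using disj by auto
  moreover have "\<exists>!A. A \<in> {rank ` e, rank ` f} \<and> v \<in> A" if "v \<in> {1..2 * r}" for v
  proof -
    have "v \<in> rank ` e \<or> v \<in> rank ` f" using that img by (simp add: image_Un flip: Un_iff)
    then show ?thesis using disj by blast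
  qed
  moreover have "rank ` e \<subseteq> {1..2 * r}" "rank ` f \<subseteq> {1..2 * r}" using img by auto
  ultimately show ?pat
    unfolding is_pattern_def P matching_def hypergraph_def msize_def verts_def edges_def by auto
qed

lemma pattern_pair:
  assumes "is_pattern r P"
  obtains A B where "P = (A \<union> B, {A, B})" "finite A" "finite B" "card A = r" "card B = r" "A \<noteq> B"
proof -
  have "card (edges P) = 2" using assms unfolding is_pattern_def msize_def by simp
  then obtain A B where AB: "edges P = {A, B}" "A \<noteq> B" by (meson card_2_iff)
  have M: "matching r P" using assms unfolding is_pattern_def by simp
  have "verts P = A \<union> B" "finite (verts P)" "card A = r" "card B = r"
    using M AB unfolding matching_def hypergraph_def by auto
  then show ?thesis using that[of A B] AB by (cases P) (auto simp: verts_def edges_def)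
qed

text \<open>An isomorphism of hypergraphs may exchange the two edges, so a pattern determines the
  matrix only up to this exchange.\<close>

lemma iso_pair_types:
  assumes "order_isomorphic (e \<union> f, {e, f}) (A \<union> B, {A, B})" "A \<noteq> B"
    and "finite e" "finite f" "card e = r" "card f = r"
  shows "has_type r (\<lambda>i j. vtx A i < vtx B j) e f \<or> has_type r (\<lambda>i j. vtx B i < vtx A j) e f"
proof -
  obtain \<phi> where mono: "strict_mono_on (e \<union> f) \<phi>" and img: "{\<phi> ` e, \<phi> ` f} = {A, B}"
    using assms(1) unfolding order_isomorphic_def verts_def edges_def by auto
  have "strict_mono_on e \<phi>" "strict_mono_on f \<phi>"
    using mono by (auto simp: monotone_on_def)
  then have v: "vtx (\<phi> ` e) i = \<phi> (vtx e i)" "vtx (\<phi> ` f) i = \<phi> (vtx f i)" if "i < r" for i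
    using vtx_strict_mono_image assms that by blast+
  have mem: "vtx e i \<in> e" "vtx f i \<in> f" if "i < r" for i
    using vtx_image assms that by blast+
  have "vtx e i < vtx f j \<longleftrightarrow> vtx (\<phi> ` e) i < vtx (\<phi> ` f) j" if "i < r" "j < r" for i j
    using mono v mem that strict_mono_on_less[OF mono, of "vtx e i" "vtx f j"] by auto
  then have "has_type r (\<lambda>i j. vtx (\<phi> ` e) i < vtx (\<phi> ` f) j) e f"
    unfolding has_type_def by blast
  moreover have "\<phi> ` e = A \<and> \<phi> ` f = B \<or> \<phi> ` e = B \<and> \<phi> ` f = A"
    using img assms(2) by (auto simp: doubleton_eq_iff)
  ultimately show ?thesis by auto
qed

lemma finite_patterns: "finite {P. is_pattern r P}"
proof (rule finite_subset)
  show "{P. is_pattern r P} \<subseteq> {{1..2 * r}} \<times> Pow (Pow {1..2 * r})"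
  proof
    fix P assume "P \<in> {P. is_pattern r P}"
    then have "fst P = {1..2 * r}" "\<forall>e\<in>snd P. e \<subseteq> fst P"
      unfolding is_pattern_def matching_def hypergraph_def verts_def edges_def by blast+
    then show "P \<in> {{1..2 * r}} \<times> Pow (Pow {1..2 * r})" by (simp add: mem_Times_iff Pow_iff) blast
  qed
qed auto

lemma pattern_exists:
  assumes "0 < r"
  shows "\<exists>P. is_pattern r P"
proof -
  let ?e = "{..<r}" and ?f = "{r..<2 * r}"
  have "has_type r (\<lambda>i j. vtx ?e i < vtx ?f j) ?e ?f" by (simp add: has_type_def)
  then show ?thesis using pair_type_pattern(2)[of ?e ?f r] assms by fastforce
qed

lemma matching_edges:
  assumes "matching r M"
  shows "finite (edges M)" "\<And>e. e \<in> edges M \<Longrightarrow> finite e \<and> card e = r" "pairwise disjnt (edges M)"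
proof -
  have fin: "finite (verts M)" and sub: "\<And>e. e \<in> edges M \<Longrightarrow> e \<subseteq> verts M"
    using assms unfolding matching_def hypergraph_def by auto
  then show "finite (edges M)" by (metis PowI finite_Pow_iff rev_finite_subset subsetI)
  show "finite e \<and> card e = r" if "e \<in> edges M" for e
    using assms that sub fin unfolding matching_def by (auto intro: finite_subset)
  show "pairwise disjnt (edges M)"
    unfolding pairwise_def disjnt_iff
  proof (intro ballI impI allI notI)
    fix e f v assume ef: "e \<in> edges M" "f \<in> edges M" "e \<noteq> f" "v \<in> e \<and> v \<in> f"
    then have "\<exists>!e. e \<in> edges M \<and> v \<in> e" using assms sub unfolding matching_def by blast
    then show False using ef by blast
  qed
qed

section \<open>Clique numbers as maxima\<close>

lemma L_pattern_bounds:
  assumes "finite (edges M)"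
  shows "E \<subseteq> edges M \<Longrightarrow> is_clique P (\<Union>E, E) \<Longrightarrow> card E \<le> L_pattern P M"
    and "(\<And>E. E \<subseteq> edges M \<Longrightarrow> is_clique P (\<Union>E, E) \<Longrightarrow> card E \<le> m) \<Longrightarrow> L_pattern P M \<le> m"
proof -
  let ?A = "{msize (\<Union>E, E) | E. E \<subseteq> edges M \<and> is_clique P (\<Union>E, E)}"
  have "?A \<subseteq> card ` Pow (edges M)" by (auto simp: msize_def edges_def)
  then have fin: "finite ?A" using assms by (meson finite_Pow_iff finite_imageI finite_subset)
  show "card E \<le> L_pattern P M" if "E \<subseteq> edges M" "is_clique P (\<Union>E, E)"
    unfolding L_pattern_def by (rule Max_ge[OF fin]) (use that in \<open>auto simp: msize_def edges_def\<close>)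
  have "is_clique P (\<Union>{}, {} :: 'a set set)" by (simp add: is_clique_def edges_def)
  then have "?A \<noteq> {}" by blast
  then show "L_pattern P M \<le> m"
    if "\<And>E. E \<subseteq> edges M \<Longrightarrow> is_clique P (\<Union>E, E) \<Longrightarrow> card E \<le> m"
    unfolding L_pattern_def using fin that by (subst Max_le_iff) (auto simp: msize_def edges_def)
qed

lemma L_matching_bounds:
  assumes "finite (edges M)" "0 < r"
  shows "is_pattern r P \<Longrightarrow> E \<subseteq> edges M \<Longrightarrow> is_clique P (\<Union>E, E) \<Longrightarrow> card E \<le> L_matching r M"
    and "(\<And>P E. is_pattern r P \<Longrightarrow> E \<subseteq> edges M \<Longrightarrow> is_clique P (\<Union>E, E) \<Longrightarrow> card E \<le> m)
      \<Longrightarrow> L_matching r M \<le> m"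
proof -
  let ?A = "{L_pattern P M | P. is_pattern r P}"
  have fin: "finite ?A" unfolding setcompr_eq_image by (rule finite_imageI[OF finite_patterns])
  show "card E \<le> L_matching r M" if "is_pattern r P" "E \<subseteq> edges M" "is_clique P (\<Union>E, E)"
  proof -
    have "L_pattern P M \<le> L_matching r M"
      unfolding L_matching_def by (rule Max_ge[OF fin]) (use that in blast)
    then show ?thesis using L_pattern_bounds(1)[OF assms(1) that(2,3)] by simp
  qed
  have "?A \<noteq> {}" using pattern_exists[OF assms(2)] by auto
  then show "L_matching r M \<le> m"
    if "\<And>P E. is_pattern r P \<Longrightarrow> E \<subseteq> edges M \<Longrightarrow> is_clique P (\<Union>E, E) \<Longrightarrow> card E \<le> m"
    unfolding L_matching_def using fin that L_pattern_bounds(2)[OF assms(1)]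
    by (subst Max_le_iff) auto
qed

section \<open>Block types\<close>

text \<open>The indices \<open>{0..<r}\<close> are divided into intervals, called blocks, and \<open>b i\<close> is the first
  index of the block of \<open>i\<close>. The matrix describes two edges whose blocks occupy consecutive regions; within
  a region, the block of the first edge lies wholly to the left, except in the blocks starting in
  \<open>S\<close>, where it lies wholly to the right.\<close>

definition block_type :: "(nat \<Rightarrow> nat) \<Rightarrow> nat set \<Rightarrow> nat \<Rightarrow> nat \<Rightarrow> bool" where
  "block_type b S i j \<longleftrightarrow> b i < b j \<or> b i = b j \<and> b i \<notin> S"


section \<open>Antichains and double counting\<close>

lemma pigeonhole_cover:
  assumes "finite I" "I \<noteq> {}" "F \<subseteq> (\<Union>i\<in>I. A i)" "\<And>i. i \<in> I \<Longrightarrow> finite (A i)"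
  shows "\<exists>i\<in>I. card F \<le> card I * card (A i)"
proof (rule ccontr)
  assume "\<not> ?thesis"
  then have less: "card I * card (A i) < card F" if "i \<in> I" for i using that by force
  have "card F \<le> card (\<Union>i\<in>I. A i)" using assms by (intro card_mono) auto
  also have "\<dots> \<le> (\<Sum>i\<in>I. card (A i))" by (rule card_UN_le[OF assms(1)])
  finally have "card I * card F \<le> (\<Sum>i\<in>I. card I * card (A i))"
    by (simp add: sum_distrib_left[symmetric])
  also have "\<dots> < (\<Sum>i\<in>I. card F)" by (rule sum_strict_mono[OF assms(1,2) less])
  finally show False by simp
qed

text \<open>Mirsky's theorem with pigeonhole: the largest size of a chain with top element \<open>x\<close> takes
  at most \<open>m\<close> values and increases strictly along the order, so its level sets are antichains.\<close>

lemma large_antichain: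
  assumes "finite F" and irr: "\<And>x. x \<in> F \<Longrightarrow> \<not> R x x"
    and trans: "\<And>x y z. x \<in> F \<Longrightarrow> y \<in> F \<Longrightarrow> z \<in> F \<Longrightarrow> R x y \<Longrightarrow> R y z \<Longrightarrow> R x z"
    and chain: "\<And>C. C \<subseteq> F \<Longrightarrow> (\<And>x y. x \<in> C \<Longrightarrow> y \<in> C \<Longrightarrow> x \<noteq> y \<Longrightarrow> R x y \<or> R y x) \<Longrightarrow> card C \<le> m"
  shows "\<exists>A\<subseteq>F. card F \<le> m * card A \<and> (\<forall>x\<in>A. \<forall>y\<in>A. \<not> R x y)"
proof (cases "F = {}")
  case False
  define \<C> where "\<C> x = {C. C \<subseteq> F \<and> (\<forall>y\<in>C. \<forall>z\<in>C. y \<noteq> z \<longrightarrow> R y z \<or> R z y) \<and>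
    x \<in> C \<and> (\<forall>y\<in>C. y \<noteq> x \<longrightarrow> R y x)}" for x
  define h where "h x = Max (card ` \<C> x)" for x
  have fin: "finite (\<C> x)" for x unfolding \<C>_def using assms(1) by simp
  have ne: "{x} \<in> \<C> x" if "x \<in> F" for x unfolding \<C>_def using that by auto
  have h: "h x \<in> {1..m}" if "x \<in> F" for x
  proof -
    have "card {x} \<le> h x" unfolding h_def by (rule Max_ge[OF finite_imageI[OF fin] imageI[OF ne[OF that]]])
    then have "1 \<le> h x" by simp
    moreover have "h x \<le> m"
      unfolding h_def using fin ne[OF that] chain by (subst Max_le_iff) (auto simp: \<C>_def)
    ultimately show ?thesis by simp
  qed
  have less: "h x < h y" if "x \<in> F" "y \<in> F" "R x y" for x y
  proof -
    have "h x \<in> card ` \<C> x" unfolding h_def using fin ne[OF that(1)] by (intro Max_in) auto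
    then obtain C where C: "C \<in> \<C> x" "h x = card C" by blast
    have Ry: "R z y" if "z \<in> C" for z
      using C that \<open>x \<in> F\<close> \<open>y \<in> F\<close> \<open>R x y\<close> trans[of z x y] unfolding \<C>_def by (cases "z = x") auto
    then have "y \<notin> C" using irr that by blast
    moreover have "finite C" using C assms(1) unfolding \<C>_def by (auto intro: finite_subset)
    moreover have "insert y C \<in> \<C> y" using C Ry that unfolding \<C>_def by auto
    ultimately have "Suc (card C) \<in> card ` \<C> y" by (metis card_insert_disjoint imageI)
    then have "Suc (card C) \<le> h y" unfolding h_def by (rule Max_ge[OF finite_imageI[OF fin]])
    then show ?thesis using C(2) by simp
  qed
  have ne: "{1..m} \<noteq> {}" using False h by fastforce
  have "\<exists>t\<in>{1..m}. card F \<le> card {1..m} * card {x \<in> F. h x = t}"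
    by (rule pigeonhole_cover[OF _ ne]) (use h assms(1) in auto)
  then obtain t where "card F \<le> m * card {x \<in> F. h x = t}" by auto
  moreover have "\<not> R x y" if "x \<in> {x \<in> F. h x = t}" "y \<in> {x \<in> F. h x = t}" for x y
    using less[of x y] that by auto
  ultimately show ?thesis by (intro exI[of _ "{x \<in> F. h x = t}"]) auto
qed auto

lemma large_common_antichain:
  assumes "finite I" "finite F"
    and irr: "\<And>s x. s \<in> I \<Longrightarrow> x \<in> F \<Longrightarrow> \<not> R s x x"
    and trans: "\<And>s x y z. s \<in> I \<Longrightarrow> x \<in> F \<Longrightarrow> y \<in> F \<Longrightarrow> z \<in> F \<Longrightarrow> R s x y \<Longrightarrow> R s y z \<Longrightarrow> R s x z"
    and chain: "\<And>s C. s \<in> I \<Longrightarrow> C \<subseteq> F \<Longrightarrow>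
      (\<And>x y. x \<in> C \<Longrightarrow> y \<in> C \<Longrightarrow> x \<noteq> y \<Longrightarrow> R s x y \<or> R s y x) \<Longrightarrow> card C \<le> m"
  shows "\<exists>A\<subseteq>F. card F \<le> m ^ card I * card A \<and> (\<forall>s\<in>I. \<forall>x\<in>A. \<forall>y\<in>A. \<not> R s x y)"
  using assms(1,3-)
proof (induction I rule: finite_induct)
  case empty
  then show ?case by auto
next
  case (insert s I)
  have "\<exists>A\<subseteq>F. card F \<le> m ^ card I * card A \<and> (\<forall>s\<in>I. \<forall>x\<in>A. \<forall>y\<in>A. \<not> R s x y)"
  proof (rule insert.IH)
    show "\<not> R t x x" if "t \<in> I" "x \<in> F" for t x using insert.prems(1)[of t x] that by simp
    show "R t x z" if "t \<in> I" "x \<in> F" "y \<in> F" "z \<in> F" "R t x y" "R t y z" for t x y z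
      using insert.prems(2)[of t x y z] that by simp
    show "card C \<le> m"
      if "t \<in> I" "C \<subseteq> F" "\<And>x y. x \<in> C \<Longrightarrow> y \<in> C \<Longrightarrow> x \<noteq> y \<Longrightarrow> R t x y \<or> R t y x" for t C
      by (rule insert.prems(3)[of t]) (use that in auto)
  qed
  then obtain A where A: "A \<subseteq> F" "card F \<le> m ^ card I * card A"
      "\<forall>s\<in>I. \<forall>x\<in>A. \<forall>y\<in>A. \<not> R s x y" by blast
  have "\<exists>B\<subseteq>A. card A \<le> m * card B \<and> (\<forall>x\<in>B. \<forall>y\<in>B. \<not> R s x y)"
  proof (rule large_antichain)
    show "finite A" using A assms(2) finite_subset by blast
    show "\<not> R s x x" if "x \<in> A" for x using insert.prems(1)[of s x] that A(1) by blast
    show "R s x z" if "x \<in> A" "y \<in> A" "z \<in> A" "R s x y" "R s y z" for x y z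
      using insert.prems(2)[of s x y z] that A by blast
    show "card C \<le> m" if "C \<subseteq> A" "\<And>x y. x \<in> C \<Longrightarrow> y \<in> C \<Longrightarrow> x \<noteq> y \<Longrightarrow> R s x y \<or> R s y x" for C
      by (rule insert.prems(3)[of s]) (use that A(1) in auto)
  qed
  then obtain B where B: "B \<subseteq> A" "card A \<le> m * card B" "\<forall>x\<in>B. \<forall>y\<in>B. \<not> R s x y" by blast
  have "card F \<le> m ^ card I * (m * card B)" using A(2) B(2) by (meson le_trans mult_le_mono2)
  then have "card F \<le> m ^ card (insert s I) * card B" using insert.hyps by (simp add: ac_simps)
  moreover have "\<forall>t\<in>insert s I. \<forall>x\<in>B. \<forall>y\<in>B. \<not> R t x y" using A(3) B(1,3) by blast
  ultimately show ?case using A(1) B(1) by (intro exI[of _ B] conjI) simp_all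
qed

text \<open>Each of the \<open>|F|\<^sup>2\<close> ordered pairs is counted, in one of its two orientations, by some pair
  \<open>(g, e)\<close>; there are \<open>|H| |F|\<close> of the latter.\<close>

lemma popular_fibre:
  assumes "finite F" "F \<noteq> {}" "finite H"
    and cover: "\<And>e f. e \<in> F \<Longrightarrow> f \<in> F \<Longrightarrow> \<exists>g\<in>H. Q g e f \<or> Q g f e"
  shows "\<exists>g\<in>H. \<exists>e\<in>F. card F \<le> 2 * card H * card {f \<in> F. Q g e f}"
proof -
  define A where "A = (\<lambda>(g, e). Pair e ` {f \<in> F. Q g e f} \<union> (\<lambda>f. (f, e)) ` {f \<in> F. Q g e f})"
  have "H \<noteq> {}" using cover assms(2) by blast
  then have "\<exists>p\<in>H \<times> F. card (F \<times> F) \<le> card (H \<times> F) * card (A p)"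
  proof (intro pigeonhole_cover)
    show "F \<times> F \<subseteq> (\<Union>p\<in>H \<times> F. A p)"
    proof (rule subrelI)
      fix e f assume ef: "(e, f) \<in> F \<times> F"
      then obtain g where "g \<in> H" "Q g e f \<or> Q g f e" using cover by blast
      then have "(e, f) \<in> A (g, e) \<or> (e, f) \<in> A (g, f)" using ef unfolding A_def by auto
      then show "(e, f) \<in> (\<Union>p\<in>H \<times> F. A p)" using ef \<open>g \<in> H\<close> by blast
    qed
  qed (use assms in \<open>auto simp: A_def\<close>)
  then obtain g e where ge: "g \<in> H" "e \<in> F" "card (F \<times> F) \<le> card (H \<times> F) * card (A (g, e))" by auto
  let ?q = "card {f \<in> F. Q g e f}"
  have "card (A (g, e)) \<le> ?q + ?q"
    unfolding A_def prod.case using assms(1)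
    by (intro order.trans[OF card_Un_le] add_mono card_image_le) auto
  then have "card (H \<times> F) * card (A (g, e)) \<le> card (H \<times> F) * (2 * ?q)"
    by (intro mult_le_mono2) simp
  with ge(3) have "card (F \<times> F) \<le> card (H \<times> F) * (2 * ?q)" by (rule order.trans)
  then have "card F * card F \<le> card F * (2 * card H * ?q)"
    by (simp only: card_cartesian_product ac_simps)
  then have "card F \<le> 2 * card H * ?q" using assms(1,2) by (simp add: card_gt_0_iff)
  then show ?thesis using ge by blast
qed

section \<open>Cuts and separated pairs\<close>

text \<open>A gap \<open>g\<close> lies between the indices \<open>g - 1\<close> and \<open>g\<close>, so the elements of \<open>G\<close> are the first
  indices of all blocks but the initial one, which starts at \<open>0\<close>.\<close>

definition block_start :: "nat set \<Rightarrow> nat \<Rightarrow> nat" where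
  "block_start G i = Max (insert 0 {g \<in> G. g \<le> i})"

lemma block_start:
  shows "block_start G i \<le> i" "block_start G i \<in> insert 0 G"
    and "g \<in> G \<Longrightarrow> g \<le> i \<Longrightarrow> g \<le> block_start G i"
proof -
  have fin: "finite (insert 0 {g \<in> G. g \<le> i})" by simp
  have "block_start G i \<in> insert 0 {g \<in> G. g \<le> i}"
    unfolding block_start_def by (rule Max_in[OF fin]) auto
  then show "block_start G i \<le> i" "block_start G i \<in> insert 0 G" by auto
  show "g \<le> block_start G i" if "g \<in> G" "g \<le> i"
    unfolding block_start_def by (rule Max_ge[OF fin]) (use that in auto)
qed

lemma block_start_between:
  assumes "block_start G i \<le> l" "l \<le> i"
  shows "block_start G l = block_start G i"
proof (rule antisym)
  have "block_start G i = 0 \<or> block_start G i \<in> G" using block_start(2) by auto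
  then show "block_start G i \<le> block_start G l"
    using block_start(3)[of "block_start G i" G l] assms by auto
  have "block_start G l = 0 \<or> block_start G l \<in> G" using block_start(2) by auto
  then show "block_start G l \<le> block_start G i"
    using block_start(3)[of "block_start G l" G i] block_start(1)[of G l] assms by auto
qed

text \<open>For a finite nonempty family this says that, at each gap in \<open>G\<close>, one point separates all
  left parts from all right parts; here the point itself is left implicit.\<close>

definition cut :: "nat set \<Rightarrow> 'a::linorder set set \<Rightarrow> bool" where
  "cut G F \<longleftrightarrow> (\<forall>g\<in>G. \<forall>e\<in>F. \<forall>f\<in>F. vtx e (g - 1) < vtx f g)"

lemma cut_less:
  assumes "cut G F" "G \<subseteq> {1..<r}" "e \<in> F" "f \<in> F" "card e = r" "card f = r"
    and "i < r" "j < r" "block_start G i < block_start G j"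
  shows "vtx e i < vtx f j"
proof -
  let ?g = "block_start G j"
  have g: "?g \<in> G" "?g \<le> j" using block_start(1,2)[of G j] assms(9) by auto
  have "i < ?g" using block_start(3)[OF g(1), of i] assms(9) by force
  then have "vtx e i \<le> vtx e (?g - 1)" using vtx_le[OF assms(5)] g assms(8) by simp
  also have "\<dots> < vtx f ?g" using assms(1,3,4) g unfolding cut_def by blast
  also have "\<dots> \<le> vtx f j" using vtx_le[OF assms(6)] g assms(8) by simp
  finally show ?thesis .
qed

text \<open>As \<open>l\<close> ranges over a block, the condition is strongest at its last index, where it says that the
  spans of this block in \<open>e\<close> and in \<open>f\<close> are disjoint.\<close>

definition separated :: "nat \<Rightarrow> nat set \<Rightarrow> 'a::linorder set \<Rightarrow> 'a set \<Rightarrow> bool" where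
  "separated r G e f \<longleftrightarrow> (\<forall>l<r. vtx e l < vtx f (block_start G l) \<or> vtx f l < vtx e (block_start G l))"

text \<open>Vertices in different blocks are compared by the cuts. Within one block the disjoint spans
  are compared through their left ends. The initial block is never reversed because \<open>e\<close> is the
  edge with the smaller first vertex.\<close>

lemma separated_has_block_type:
  assumes "cut G F" "G \<subseteq> {1..<r}" "e \<in> F" "f \<in> F" "card e = r" "card f = r"
    and sep: "separated r G e f" and first: "vtx e 0 < vtx f 0"
  shows "has_type r (block_type (block_start G) {g \<in> G. vtx f g < vtx e g}) e f"
  unfolding has_type_def
proof (intro allI impI)
  let ?b = "block_start G" and ?S = "{g \<in> G. vtx f g < vtx e g}"
  fix i j assume ij: "i < r" "j < r"
  consider "?b i < ?b j" | "?b j < ?b i" | "?b i = ?b j" by linarith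
  then show "vtx e i < vtx f j \<longleftrightarrow> block_type ?b ?S i j"
  proof cases
    case 1
    then show ?thesis using cut_less[OF assms(1-6) ij] by (simp add: block_type_def)
  next
    case 2
    then show ?thesis using cut_less[OF assms(1,2,4,3,6,5) ij(2,1)] by (simp add: block_type_def)
  next
    case 3
    define l where "l = max i j"
    have l: "i \<le> l" "j \<le> l" "l < r" "?b l = ?b i" using ij 3 by (auto simp: l_def max_def)
    have b: "?b l \<le> i" "?b l \<le> j" "?b l \<le> l" using l 3 block_start(1)[of G i] block_start(1)[of G j] by auto
    have e: "vtx e (?b l) \<le> vtx e i" "vtx e i \<le> vtx e l" "vtx e (?b l) \<le> vtx e l"
      using vtx_le[OF assms(5)] b l ij by auto
    have f: "vtx f (?b l) \<le> vtx f j" "vtx f j \<le> vtx f l" "vtx f (?b l) \<le> vtx f l"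
      using vtx_le[OF assms(6)] b l ij by auto
    from sep l(3) consider "vtx e l < vtx f (?b l)" | "vtx f l < vtx e (?b l)"
      unfolding separated_def by blast
    then show ?thesis
    proof cases
      case 1
      then show ?thesis using e f 3 l by (auto simp: block_type_def)
    next
      case 2
      have "?b l \<noteq> 0" using 2 f first by (metis less_asym' le_less_trans)
      then have "?b l \<in> ?S" using block_start(2)[of G l] 2 f by auto
      then show ?thesis using e f 2 3 l by (auto simp: block_type_def)
    qed
  qed
qed

lemma block_type_trans:
  assumes "cut G F" "G \<subseteq> {1..<r}" "e \<in> F" "f \<in> F" "h \<in> F" "card e = r" "card h = r"
    and ef: "has_type r (block_type (block_start G) S) e f"
    and fh: "has_type r (block_type (block_start G) S) f h"
  shows "has_type r (block_type (block_start G) S) e h"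
  unfolding has_type_def
proof (intro allI impI)
  let ?b = "block_start G"
  fix i j assume ij: "i < r" "j < r"
  consider "?b i < ?b j" | "?b j < ?b i" | "?b i = ?b j" by linarith
  then show "vtx e i < vtx h j \<longleftrightarrow> block_type ?b S i j"
  proof cases
    case 1
    then show ?thesis using cut_less[OF assms(1,2,3,5,6,7) ij] by (simp add: block_type_def)
  next
    case 2
    then show ?thesis using cut_less[OF assms(1,2,5,3,7,6) ij(2,1)] by (simp add: block_type_def)
  next
    case 3
    have "vtx e i < vtx f i \<longleftrightarrow> ?b i \<notin> S" using ef ij unfolding has_type_def block_type_def by auto
    moreover have "vtx f i < vtx h j \<longleftrightarrow> ?b i \<notin> S"
      using fh ij 3 unfolding has_type_def block_type_def by auto
    ultimately show ?thesis using 3 unfolding block_type_def by auto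
  qed
qed

text \<open>The left end of the block of \<open>e\<close> that contains \<open>g\<close> is a point that separates the two sides
  of the gap \<open>g\<close> in \<open>f\<close>. The inequality is weak on the left so that \<open>e\<close> can split itself.\<close>

definition splits :: "nat set \<Rightarrow> nat \<Rightarrow> 'a::linorder set \<Rightarrow> 'a set \<Rightarrow> bool" where
  "splits G g e f \<longleftrightarrow> vtx f (g - 1) \<le> vtx e (block_start G g) \<and> vtx e (block_start G g) < vtx f g"

text \<open>The first vertex of the block of \<open>f\<close> that lies to the right of the left end in \<open>e\<close> sits just
  after the gap.\<close>

lemma splitting_gap:
  assumes "l < r" "vtx f (block_start G l) \<le> vtx e (block_start G l)"
    "vtx e (block_start G l) < vtx f l"
  shows "\<exists>g\<in>{1..<r} - G. splits G g e f"
proof -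
  let ?b = "block_start G l"
  define g where "g = (LEAST g. ?b \<le> g \<and> vtx e ?b < vtx f g)"
  have ex: "?b \<le> l \<and> vtx e ?b < vtx f l" using assms block_start(1) by blast
  have g: "?b \<le> g" "vtx e ?b < vtx f g" using LeastI[of "\<lambda>g. ?b \<le> g \<and> vtx e ?b < vtx f g", OF ex]
    unfolding g_def by auto
  have gl: "g \<le> l" unfolding g_def by (rule Least_le) (rule ex)
  have "?b \<noteq> g" using g assms(2) by force
  then have bg: "?b < g" using g by simp
  then have "?b \<le> g - 1" "g - 1 < g" by auto
  then have prev: "vtx f (g - 1) \<le> vtx e ?b"
    using not_less_Least[of "g - 1" "\<lambda>g. ?b \<le> g \<and> vtx e ?b < vtx f g"] unfolding g_def by force
  have "g \<notin> G" using block_start(3)[of g G l] gl bg by auto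
  moreover have "block_start G g = ?b" by (rule block_start_between[OF g(1) gl])
  ultimately show ?thesis using g prev bg gl assms(1) unfolding splits_def by (intro bexI[of _ g]) auto
qed

text \<open>If two spans intersect, the larger of their left ends lies in both.\<close>

lemma not_separated_splits:
  assumes "card e = r" "card f = r" "finite e" "finite f" "e \<inter> f = {}" "\<not> separated r G e f"
  shows "\<exists>g\<in>{1..<r} - G. splits G g e f \<or> splits G g f e"
proof -
  obtain l where l: "l < r" "vtx f (block_start G l) \<le> vtx e l" "vtx e (block_start G l) \<le> vtx f l"
    using assms(6) unfolding separated_def by (auto simp: not_less)
  have b: "block_start G l < r" using block_start(1)[of G l] l by simp
  have neq: "vtx e i \<noteq> vtx f j" if "i < r" "j < r" for i j
    using vtx_image[OF assms(3,1)] vtx_image[OF assms(4,2)] assms(5) that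
    by (metis disjoint_iff imageI lessThan_iff)
  have "vtx f (block_start G l) < vtx e l" "vtx e (block_start G l) < vtx f l"
    using l neq[of "block_start G l" l] neq[of l "block_start G l"] b by (auto simp: le_less)
  then show ?thesis
    using splitting_gap[of l r f G e] splitting_gap[of l r e G f] l(1)
    by (cases "vtx f (block_start G l) \<le> vtx e (block_start G l)") (auto simp: not_le intro: less_imp_le)
qed

text \<open>In the double count also the pairs \<open>(e, e)\<close> must be covered. The left end of a block with
  more than one vertex splits its own edge right behind the first vertex of the block.\<close>

lemma self_splits:
  assumes "card e = r" "h \<in> {1..<r} - G" "G \<subseteq> {1..<r}"
  shows "\<exists>g\<in>{1..<r} - G. splits G g e e"
proof (rule splitting_gap)
  have "block_start G h \<noteq> h" using block_start(2)[of G h] assms by auto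
  then have "block_start G h < h" using block_start(1)[of G h] by simp
  then show "vtx e (block_start G h) < vtx e h" using vtx_less[OF assms(1)] assms(2) by auto
qed (use assms in auto)

section \<open>Matchings without large cliques are small\<close>

lemma type_clique:
  fixes C :: "'a::linorder set set"
  assumes "\<And>e. e \<in> C \<Longrightarrow> finite e \<and> card e = r" "pairwise disjnt C" "0 < r"
    and "\<And>e f. e \<in> C \<Longrightarrow> f \<in> C \<Longrightarrow> e \<noteq> f \<Longrightarrow> has_type r T e f \<or> has_type r T f e"
  shows "\<exists>P. is_pattern r P \<and> is_clique P (\<Union>C, C)"
proof (cases "\<exists>e\<in>C. \<exists>f\<in>C. e \<noteq> f")
  case True
  have pair: "order_isomorphic (e \<union> f, {e, f}) (type_pattern r T) \<and> is_pattern r (type_pattern r T)"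
    if ef: "e \<in> C" "f \<in> C" "e \<noteq> f" for e f
  proof -
    have disj: "e \<inter> f = {}" "f \<inter> e = {}" using assms(2) ef by (auto simp: pairwise_def disjnt_def)
    have e: "finite e" "card e = r" and f: "finite f" "card f = r" using assms(1) ef(1,2) by auto
    from assms(4)[OF ef] show ?thesis
    proof
      assume "has_type r T e f"
      then show ?thesis using pair_type_pattern[OF e(1) f(1) e(2) f(2) disj(1) assms(3)] by simp
    next
      assume "has_type r T f e"
      then show ?thesis
        using pair_type_pattern[OF f(1) e(1) f(2) e(2) disj(2) assms(3)]
        by (simp add: Un_commute insert_commute)
    qed
  qed
  obtain e f where "e \<in> C" "f \<in> C" "e \<noteq> f" using True by blast
  then have "is_pattern r (type_pattern r T)" using pair by blast
  moreover have "is_clique (type_pattern r T) (\<Union>C, C)"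
    unfolding is_clique_def edges_def snd_conv using pair by blast
  ultimately show ?thesis by blast
next
  case False
  then have "is_clique P (\<Union>C, C)" for P unfolding is_clique_def edges_def snd_conv by blast
  then show ?thesis using pattern_exists[OF assms(3)] by blast
qed

definition clique_bounded :: "nat \<Rightarrow> nat \<Rightarrow> 'a::linorder set set \<Rightarrow> bool" where
  "clique_bounded r m F \<longleftrightarrow> 0 < r \<and> finite F \<and> (\<forall>e\<in>F. finite e \<and> card e = r) \<and> pairwise disjnt F \<and>
     (\<forall>P E. is_pattern r P \<longrightarrow> E \<subseteq> F \<longrightarrow> is_clique P (\<Union>E, E) \<longrightarrow> card E \<le> m)"

lemma clique_boundedD:
  assumes "clique_bounded r m F"
  shows "0 < r" "finite F" "e \<in> F \<Longrightarrow> finite e" "e \<in> F \<Longrightarrow> card e = r"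
    "e \<in> F \<Longrightarrow> f \<in> F \<Longrightarrow> e \<noteq> f \<Longrightarrow> e \<inter> f = {}"
    "is_pattern r P \<Longrightarrow> E \<subseteq> F \<Longrightarrow> is_clique P (\<Union>E, E) \<Longrightarrow> card E \<le> m"
  using assms unfolding clique_bounded_def pairwise_def disjnt_def by blast+

lemma clique_bounded_subset:
  assumes "clique_bounded r m F" "E \<subseteq> F"
  shows "clique_bounded r m E"
  using assms finite_subset[OF assms(2)] pairwise_subset[of disjnt F E]
  unfolding clique_bounded_def by (auto dest: subset_trans)

text \<open>The relations for the \<open>2\<^bsup>|G|\<^esup>\<close> sets \<open>S\<close> of reversed blocks are strict partial orders with
  short chains. A separated pair is comparable in one of them, so a common antichain has no
  separated pair.\<close>

lemma large_unseparated:
  fixes F :: "'a::linorder set set"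
  assumes F: "clique_bounded r m F"
    and G: "G \<subseteq> {1..<r}" "cut G F"
  shows "\<exists>A\<subseteq>F. card F \<le> m ^ 2 ^ card G * card A \<and>
    (\<forall>e\<in>A. \<forall>f\<in>A. e \<noteq> f \<longrightarrow> \<not> separated r G e f)"
proof -
  let ?R = "\<lambda>S. has_type r (block_type (block_start G) S)"
  have finG: "finite G" using G(1) finite_subset by blast
  have "\<exists>A\<subseteq>F. card F \<le> m ^ card (Pow G) * card A \<and> (\<forall>S\<in>Pow G. \<forall>e\<in>A. \<forall>f\<in>A. \<not> ?R S e f)"
  proof (rule large_common_antichain)
    fix S e assume S: "S \<in> Pow G"
    have "block_start G 0 = 0" using block_start(1)[of G 0] by simp
    moreover have "0 \<notin> S" using S G(1) by auto
    ultimately have "block_type (block_start G) S 0 0" by (simp add: block_type_def)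
    then show "\<not> ?R S e e" using clique_boundedD(1)[OF F] unfolding has_type_def by blast
  next
    fix S e f h assume "e \<in> F" "f \<in> F" "h \<in> F" "?R S e f" "?R S f h"
    then show "?R S e h" using block_type_trans[OF G(2,1)] clique_boundedD(4)[OF F] by blast
  next
    fix S C assume C: "C \<subseteq> F" "\<And>e f. e \<in> C \<Longrightarrow> f \<in> C \<Longrightarrow> e \<noteq> f \<Longrightarrow> ?R S e f \<or> ?R S f e"
    have CB: "clique_bounded r m C" by (rule clique_bounded_subset[OF F C(1)])
    have "\<exists>P. is_pattern r P \<and> is_clique P (\<Union>C, C)"
      by (rule type_clique) (use CB C(2) in \<open>auto simp: clique_bounded_def\<close>)
    then show "card C \<le> m" using clique_boundedD(6)[OF F _ C(1)] by blast
  qed (use clique_boundedD(2)[OF F] finG in auto)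
  then obtain A where A: "A \<subseteq> F" "card F \<le> m ^ 2 ^ card G * card A"
      "\<And>S e f. S \<subseteq> G \<Longrightarrow> e \<in> A \<Longrightarrow> f \<in> A \<Longrightarrow> \<not> ?R S e f"
    using finG by (auto simp: card_Pow)
  have "\<not> separated r G e f" if ef: "e \<in> A" "f \<in> A" "e \<noteq> f" for e f
  proof
    assume sep: "separated r G e f"
    then have sep': "separated r G f e" unfolding separated_def by blast
    have F': "e \<in> F" "f \<in> F" using ef A(1) by auto
    note D = clique_boundedD[OF F]
    have c: "card e = r" "card f = r" using D(4) F' by auto
    have "vtx e 0 \<in> e" "vtx f 0 \<in> f"
      using vtx_image[OF D(3) D(4)] F' D(1) by blast+
    then have "vtx e 0 \<noteq> vtx f 0" using D(5)[OF F' ef(3)] by auto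
    then consider "vtx e 0 < vtx f 0" | "vtx f 0 < vtx e 0" by force
    then show False
    proof cases
      case 1
      show ?thesis
        by (rule notE[OF A(3) separated_has_block_type[OF G(2,1) F' c sep 1]]) (use ef in auto)
    next
      case 2
      show ?thesis
        by (rule notE[OF A(3) separated_has_block_type[OF G(2,1) F'(2,1) c(2,1) sep' 2]]) (use ef in auto)
    qed
  qed
  then show ?thesis using A by blast
qed

text \<open>The induction is on the number \<open>k\<close> of gaps that are still uncut. Each step replaces the
  family by a common antichain, at the cost of a factor \<open>m\<^bsup>2\<^bsup>|G|\<^esup>\<^esup>\<close>, and then by the edges that are
  split at one popular gap, at the cost of a factor \<open>2 k\<close>. When no gap is left, any two edges
  are separated, so the antichain has at most one element.\<close>

lemma card_le_of_cut:
  fixes F :: "'a::linorder set set"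
  assumes "clique_bounded r m F" "G \<subseteq> {1..<r}" "cut G F" "card ({1..<r} - G) = k"
  shows "card F \<le> 2 ^ k * fact k * m ^ (\<Sum>j=card G..<r. 2 ^ j)"
  using assms
proof (induction k arbitrary: F G)
  case (0 F G)
  note D = clique_boundedD[OF 0(1)]
  obtain A where A: "A \<subseteq> F" "card F \<le> m ^ 2 ^ card G * card A"
      "\<And>e f. e \<in> A \<Longrightarrow> f \<in> A \<Longrightarrow> e \<noteq> f \<Longrightarrow> \<not> separated r G e f"
    using large_unseparated[OF 0(1-3)] by metis
  have G: "{1..<r} - G = {}" using 0(4) by simp
  have "e = f" if ef: "e \<in> A" "f \<in> A" for e f
  proof (rule ccontr)
    assume "e \<noteq> f"
    have F: "e \<in> F" "f \<in> F" using ef A(1) by auto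
    then show False
      using not_separated_splits[of e r f G] A(3)[OF ef \<open>e \<noteq> f\<close>] D(3-5) \<open>e \<noteq> f\<close>
      unfolding G by simp
  qed
  then have "card A \<le> 1"
    by (metis One_nat_def card_le_Suc0_iff_eq A(1) D(2) finite_subset)
  then have "card F \<le> m ^ 2 ^ card G" using A(2) by (metis le_trans mult.right_neutral mult_le_mono2)
  moreover have "G = {1..<r}" using G 0(2) by blast
  then have "card G = r - 1" by simp
  then have "(\<Sum>j=card G..<r. 2 ^ j) = (2::nat) ^ card G"
    using D(1) by (simp add: sum.atLeast_Suc_lessThan)
  ultimately show ?case by simp
next
  case (Suc k F G)
  note D = clique_boundedD[OF Suc.prems(1)]
  let ?H = "{1..<r} - G"
  obtain A where A: "A \<subseteq> F" "card F \<le> m ^ 2 ^ card G * card A"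
      "\<And>e f. e \<in> A \<Longrightarrow> f \<in> A \<Longrightarrow> e \<noteq> f \<Longrightarrow> \<not> separated r G e f"
    using large_unseparated[OF Suc.prems(1-3)] by metis
  show ?case
  proof (cases "A = {}")
    case False
    have finA: "finite A" using A(1) D(2) finite_subset by blast
    obtain h where h: "h \<in> ?H" using Suc.prems(4) by (metis card.empty equals0I nat.distinct(1))
    have "\<exists>g\<in>?H. splits G g e f \<or> splits G g f e" if ef: "e \<in> A" "f \<in> A" for e f
    proof -
      have F: "e \<in> F" "f \<in> F" using ef A(1) by auto
      then have c: "finite e \<and> card e = r" "finite f \<and> card f = r" by (simp_all add: D(3,4))
      show ?thesis
      proof (cases "e = f")
        case True
        then show ?thesis using self_splits[OF _ h Suc.prems(2), of e] c(1) by simp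
      next
        case False
        then have "e \<inter> f = {}" using D(5) F by simp
        then show ?thesis
          using not_separated_splits[of e r f G] A(3)[OF ef False] c by simp
      qed
    qed
    then have "\<exists>g\<in>?H. \<exists>e\<in>A. card A \<le> 2 * card ?H * card {f \<in> A. splits G g e f}"
      by (intro popular_fibre[OF finA False]) auto
    then obtain g e where
      g: "g \<in> ?H" and le: "card A \<le> 2 * card ?H * card {f \<in> A. splits G g e f}" by blast
    let ?B = "{f \<in> A. splits G g e f}"
    have sub: "?B \<subseteq> F" using A(1) by blast
    have cut: "cut (insert g G) ?B"
      unfolding cut_def
    proof (intro ballI)
      fix h a b assume h: "h \<in> insert g G" and ab: "a \<in> ?B" "b \<in> ?B"
      show "vtx a (h - 1) < vtx b h"
      proof (cases "h = g")
        case True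
        then show ?thesis using ab unfolding splits_def by (auto intro: le_less_trans)
      next
        case False
        then show ?thesis using Suc.prems(3) h ab sub unfolding cut_def by blast
      qed
    qed
    have "card ?B \<le> 2 ^ k * fact k * m ^ (\<Sum>j=card (insert g G)..<r. 2 ^ j)"
    proof (rule Suc.IH)
      show "insert g G \<subseteq> {1..<r}" using g Suc.prems(2) by blast
      have "{1..<r} - insert g G = ?H - {g}" by blast
      then show "card ({1..<r} - insert g G) = k" using g Suc.prems(4) by simp
    qed (rule clique_bounded_subset[OF Suc.prems(1) sub], rule cut)
    moreover have "finite G" using Suc.prems(2) finite_subset by blast
    then have cG: "card (insert g G) = Suc (card G)" using g by simp
    moreover have "Suc (card G) \<le> card {1..<r}"
      unfolding cG[symmetric] using g Suc.prems(2) by (intro card_mono) auto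
    then have "(\<Sum>j=card G..<r. 2 ^ j) = (2::nat) ^ card G + (\<Sum>j=Suc (card G)..<r. 2 ^ j)"
      by (intro sum.atLeast_Suc_lessThan) simp
    ultimately have B: "m ^ 2 ^ card G * card ?B \<le> 2 ^ k * fact k * m ^ (\<Sum>j=card G..<r. 2 ^ j)"
      using mult_le_mono2[of "card ?B" _ "m ^ 2 ^ card G"] by (simp add: power_add ac_simps)
    have "card F \<le> m ^ 2 ^ card G * (2 * Suc k * card ?B)"
      by (rule order.trans[OF A(2) mult_le_mono2[OF le[unfolded Suc.prems(4)]]])
    also have "\<dots> = 2 * Suc k * (m ^ 2 ^ card G * card ?B)" by (simp only: ac_simps)
    also have "\<dots> \<le> 2 * Suc k * (2 ^ k * fact k * m ^ (\<Sum>j=card G..<r. 2 ^ j))"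
      by (rule mult_le_mono2[OF B])
    also have "\<dots> = 2 ^ Suc k * fact (Suc k) * m ^ (\<Sum>j=card G..<r. 2 ^ j)"
      by (simp add: algebra_simps)
    finally show ?thesis .
  qed (use A(2) in simp)
qed

lemma matching_size_le:
  fixes M :: "'a::linorder ordered_hypergraph"
  assumes "matching r M" "0 < r"
  shows "msize M \<le> 2 ^ (r - 1) * fact (r - 1) * L_matching r M ^ (2 ^ r - 1)"
proof -
  note M = matching_edges[OF assms(1)]
  have "clique_bounded r (L_matching r M) (edges M)"
    unfolding clique_bounded_def using M L_matching_bounds(1)[OF M(1) assms(2)] assms(2) by blast
  from card_le_of_cut[OF this, of "{}"]
  have "card (edges M) \<le>
      2 ^ (r - 1) * fact (r - 1) * L_matching r M ^ (\<Sum>j=card ({}::nat set)..<r. 2 ^ j)"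
    by (simp add: cut_def)
  moreover have "(\<Sum>j=card ({}::nat set)..<r. 2 ^ j) = (2::nat) ^ r - 1"
    using sum_power2[of r] by simp
  ultimately show ?thesis unfolding msize_def by simp
qed


section \<open>A matching with many edges and no large clique\<close>

lemma lex_less_iff:
  fixes a b c d n :: nat
  assumes "c < n" "d < n"
  shows "a * n + c < b * n + d \<longleftrightarrow> a < b \<or> a = b \<and> c < d"
proof -
  have less: "x * n + z < y * n + w" if "x < y" "z < n" for x y z w :: nat
  proof -
    have "x * n + z < Suc x * n" using that by simp
    also have "\<dots> \<le> y * n" using that by (intro mult_le_mono1) simp
    finally show ?thesis by simp
  qed
  show ?thesis using less[of a b c d] less[of b a d c] assms by (cases a b rule: linorder_cases) auto
qed

lemma lex_eq_iff:
  fixes a b c d n :: nat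
  assumes "c < n" "d < n"
  shows "a * n + c = b * n + d \<longleftrightarrow> a = b \<and> c = d"
  using lex_less_iff[OF assms, of a b] lex_less_iff[OF assms(2,1), of b a] by auto

text \<open>The blocks are the singletons \<open>{0}, \<dots>, {k-1}\<close> and the final block \<open>{k..<r}\<close>, where \<open>k\<close> is
  the first component of \<open>p\<close>; hence \<open>min i k\<close> is the start of the block of \<open>i\<close>. Vertices are sorted by block
  first. Within a block they are sorted by the letter \<open>t\<close>, in decreasing order if the block is
  reversed.\<close>

definition digit :: "nat \<Rightarrow> nat \<times> nat set \<Rightarrow> nat \<Rightarrow> nat \<Rightarrow> nat" where
  "digit m p t i =
    min i (fst p) * m + (if min i (fst p) \<in> snd p then m - 1 - t else t)"

definition prefix_type :: "nat \<times> nat set \<Rightarrow> nat \<Rightarrow> nat \<Rightarrow> bool" where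
  "prefix_type p = block_type (\<lambda>i. min i (fst p)) (snd p)"

lemma digit_less_iff:
  assumes "t < m" "u < m"
  shows "digit m p t i < digit m p u j \<longleftrightarrow>
    min i (fst p) < min j (fst p) \<or>
    min i (fst p) = min j (fst p) \<and> (if min i (fst p) \<in> snd p then u < t else t < u)"
proof -
  have "(if min i (fst p) \<in> snd p then m - 1 - t else t) < m"
    "(if min j (fst p) \<in> snd p then m - 1 - u else u) < m" using assms by auto
  from lex_less_iff[OF this] show ?thesis using assms unfolding digit_def by auto
qed

lemma digit_eq_iff:
  assumes "t < m" "u < m"
  shows "digit m p t i = digit m p u j \<longleftrightarrow> min i (fst p) = min j (fst p) \<and> t = u"
proof -
  have "(if min i (fst p) \<in> snd p then m - 1 - t else t) < m"
    "(if min j (fst p) \<in> snd p then m - 1 - u else u) < m" using assms by auto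
  from lex_eq_iff[OF this] show ?thesis using assms unfolding digit_def by auto
qed

lemma digit_less_bound:
  assumes "t < m" "i < r"
  shows "digit m p t i < r * m"
proof -
  have "digit m p t i < Suc (min i (fst p)) * m" using assms unfolding digit_def by auto
  also have "\<dots> \<le> r * m" using assms by (intro mult_le_mono1) simp
  finally show ?thesis .
qed

text \<open>The position of the vertex with index \<open>i\<close> in the edge labelled by a word. It is the number
  whose digits are given by the successive letters, followed by the index; the
  factor \<open>r * (r * m) ^ length ps\<close> exceeds everything that the remaining letters contribute.\<close>

fun pos :: "nat \<Rightarrow> nat \<Rightarrow> (nat \<times> nat set) list \<Rightarrow> nat list \<Rightarrow> nat \<Rightarrow> nat" where
  "pos r m (p # ps) (t # x) i = digit m p t i * (r * (r * m) ^ length ps) + pos r m ps x i"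
| "pos r m _ _ i = i"

definition labels :: "nat \<Rightarrow> nat \<Rightarrow> nat list set" where
  "labels m d = {x. set x \<subseteq> {..<m} \<and> length x = d}"

lemma labels_Suc: "x \<in> labels m (Suc d) \<longleftrightarrow> (\<exists>t y. x = t # y \<and> t < m \<and> y \<in> labels m d)"
  unfolding labels_def by (cases x) auto

lemma pos_less:
  assumes "x \<in> labels m (length ps)" "i < r"
  shows "pos r m ps x i < r * (r * m) ^ length ps"
  using assms
proof (induction ps arbitrary: x)
  case (Cons p ps)
  then obtain t y where x: "x = t # y" "t < m" "y \<in> labels m (length ps)" by (auto simp: labels_Suc)
  let ?N = "r * (r * m) ^ length ps"
  have "pos r m (p # ps) x i < Suc (digit m p t i) * ?N" using Cons.IH[OF x(3) Cons.prems(2)] x by simp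
  also have "\<dots> \<le> r * m * ?N"
    by (intro mult_le_mono1 Suc_leI digit_less_bound x(2) Cons.prems(2))
  finally show ?case by (simp add: ac_simps)
qed (auto simp: labels_def)

lemma pos_strict_mono:
  assumes "x \<in> labels m (length ps)"
  shows "strict_mono_on {..<r} (pos r m ps x)"
proof (rule strict_mono_onI)
  fix i j assume "i \<in> {..<r}" "j \<in> {..<r}" "i < j"
  then have ij: "i < r" "j < r" "i < j" by auto
  show "pos r m ps x i < pos r m ps x j"
    using assms
  proof (induction ps arbitrary: x)
    case (Cons p ps)
    then obtain t y where x: "x = t # y" "t < m" "y \<in> labels m (length ps)" by (auto simp: labels_Suc)
    have "min i (fst p) \<le> min j (fst p)" using ij by simp
    then have "digit m p t i < digit m p t j \<or> digit m p t i = digit m p t j"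
      unfolding digit_less_iff[OF x(2,2)] digit_eq_iff[OF x(2,2)] by auto
    then show ?case
      using Cons.IH[OF x(3)] x(1) lex_less_iff[OF pos_less[OF x(3) ij(1)] pos_less[OF x(3) ij(2)]]
      by auto
  qed (use ij in \<open>auto simp: labels_def\<close>)
qed

lemma pos_inj:
  assumes "x \<in> labels m (length ps)" "y \<in> labels m (length ps)" "i < r" "j < r"
    "pos r m ps x i = pos r m ps y j"
  shows "x = y"
  using assms(1,2,5)
proof (induction ps arbitrary: x y)
  case (Cons p ps)
  then obtain t x' u y' where x: "x = t # x'" "t < m" "x' \<in> labels m (length ps)"
    and y: "y = u # y'" "u < m" "y' \<in> labels m (length ps)" by (auto simp: labels_Suc)
  have "digit m p t i = digit m p u j" "pos r m ps x' i = pos r m ps y' j"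
    using Cons.prems(3) lex_eq_iff[OF pos_less[OF x(3) assms(3)] pos_less[OF y(3) assms(4)]]
    unfolding x y by auto
  then show ?case using Cons.IH[OF x(3) y(3)] digit_eq_iff[OF x(2) y(2)] x y by auto
qed (auto simp: labels_def)

text \<open>A letter on which \<open>x\<close> and \<open>y\<close> agree compares only the block starts \<open>min i k\<close>. Since the list is
  sorted, the blocks of the letter \<open>l\<close> refine these blocks, so this comparison agrees
  with the matrix of \<open>l\<close>. The letter \<open>l\<close> itself decides all remaining comparisons between
  different edges.\<close>

lemma pos_less_iff:
  assumes "sorted (map fst ps)" "x \<in> labels m (length ps)" "y \<in> labels m (length ps)"
    "l < length ps" "take l x = take l y" "x ! l < y ! l" "i < r" "j < r"
  shows "pos r m ps x i < pos r m ps y j \<longleftrightarrow> prefix_type (ps ! l) i j"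
  using assms(1-6)
proof (induction ps arbitrary: x y l)
  case (Cons p ps)
  then obtain t x' u y' where x: "x = t # x'" "t < m" "x' \<in> labels m (length ps)"
    and y: "y = u # y'" "u < m" "y' \<in> labels m (length ps)" by (auto simp: labels_Suc)
  have lex: "pos r m (p # ps) x i < pos r m (p # ps) y j \<longleftrightarrow>
      digit m p t i < digit m p u j \<or> digit m p t i = digit m p u j \<and> pos r m ps x' i < pos r m ps y' j"
    using lex_less_iff[OF pos_less[OF x(3) assms(7)] pos_less[OF y(3) assms(8)]] x y by simp
  show ?case
  proof (cases l)
    case 0
    then have "t < u" using Cons.prems(6) x y by simp
    then show ?thesis unfolding lex digit_less_iff[OF x(2) y(2)] digit_eq_iff[OF x(2) y(2)]
      using 0 by (auto simp: prefix_type_def block_type_def)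
  next
    case (Suc l')
    then have l': "l' < length ps" "take l' x' = take l' y'" "x' ! l' < y' ! l'" and tu: "t = u"
      using Cons.prems x y by auto
    have IH: "pos r m ps x' i < pos r m ps y' j \<longleftrightarrow> prefix_type (ps ! l') i j"
      using Cons.IH[OF _ x(3) y(3) l'] Cons.prems(1) by simp
    have k: "fst p \<le> fst (ps ! l')" using Cons.prems(1) l'(1) by simp
    show ?thesis
      unfolding lex digit_less_iff[OF x(2) y(2)] digit_eq_iff[OF x(2) y(2)] IH
      using k Suc tu by (auto simp: prefix_type_def block_type_def min_def split: if_splits)
  qed
qed auto

text \<open>If \<open>k < k'\<close>, the indices \<open>k\<close> and \<open>k + 1\<close> lie in one block for \<open>k\<close> but in different blocks
  for \<open>k'\<close>. In the latter case index \<open>k\<close> of either edge precedes index \<open>k + 1\<close> of the other, in the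
  former case this holds for one of the two edges only. For equal \<open>k\<close> the set of reversed blocks can be read off the diagonal.\<close>

lemma prefix_type_inj:
  assumes "p \<in> (SIGMA k:{..<r}. Pow {1..k})" "q \<in> (SIGMA k:{..<r}. Pow {1..k})"
    and eq: "\<And>i j. i < r \<Longrightarrow> j < r \<Longrightarrow> prefix_type p i j \<longleftrightarrow> prefix_type q i j"
  shows "p = q"
proof -
  obtain k S k' S' where p: "p = (k, S)" and q: "q = (k', S')" by fastforce
  have le: "b \<le> a" if "a < r" "b < r"
      "\<And>i j. i < r \<Longrightarrow> j < r \<Longrightarrow> prefix_type (a, A) i j \<longleftrightarrow> prefix_type (b, B) i j" for a b A B
  proof (rule ccontr)
    assume "\<not> b \<le> a"
    then show False using that(3)[of a "Suc a"] that(3)[of "Suc a" a] that(2)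
      by (auto simp: prefix_type_def block_type_def)
  qed
  have k: "k = k'" using le[of k k' S S'] le[of k' k S' S] assms unfolding p q by force
  have "g \<in> S \<longleftrightarrow> g \<in> S'" if "g \<in> {1..k}" for g
    using eq[of g g] that assms(1) k unfolding p q by (auto simp: prefix_type_def block_type_def)
  then have "S = S'" using assms(1,2) k unfolding p q by blast
  then show ?thesis using p q k by simp
qed

lemma first_difference:
  assumes "length x = length y" "x \<noteq> y"
  shows "\<exists>l<length x. take l x = take l y \<and> x ! l \<noteq> y ! l"
  using assms
proof (induction x y rule: list_induct2)
  case (Cons a x b y)
  show ?case
  proof (cases "a = b")
    case True
    then obtain l where "l < length x" "take l x = take l y" "x ! l \<noteq> y ! l" using Cons by auto
    then show ?thesis using True by (intro exI[of _ "Suc l"]) auto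
  qed (intro exI[of _ 0], simp)
qed simp

lemma enumerate_types:
  obtains ps where "distinct ps" "sorted (map fst ps)" "set ps = (SIGMA k:{..<r}. Pow {1..k})"
    "length ps = 2 ^ r - (1::nat)"
proof -
  let ?T = "SIGMA k:{..<r}. Pow {1..k}"
  have "finite ?T" by auto
  then obtain qs where qs: "set qs = ?T" "distinct qs" using finite_distinct_list by blast
  have "card ?T = (\<Sum>k<r. 2 ^ k)" by (simp add: card_Pow)
  also have "\<dots> = 2 ^ r - 1" using sum_power2[of r] by (simp add: lessThan_atLeast0)
  finally have "length qs = 2 ^ r - 1" using qs distinct_card by metis
  then show ?thesis using qs that[of "sort_key fst qs"] by simp
qed

text \<open>In a clique all pairs have the same matrix once the edge with the smaller first vertex is
  listed first. By injectivity of the types, all pairs of words then first differ at the same letter, and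
  this letter distinguishes the elements of the clique.\<close>

lemma matching_without_large_clique:
  assumes "0 < r" "n \<le> m ^ (2 ^ r - 1)"
  shows "\<exists>M :: nat ordered_hypergraph. matching r M \<and> msize M = n \<and> L_matching r M \<le> m"
proof -
  obtain ps where ps: "distinct ps" "sorted (map fst ps)" "set ps = (SIGMA k:{..<r}. Pow {1..k})"
      "length ps = 2 ^ r - 1"
    by (rule enumerate_types)
  define X where "X = labels m (length ps)"
  have finX: "finite X" and cardX: "card X = m ^ (2 ^ r - 1)"
    unfolding X_def labels_def using ps(4) by (simp_all add: finite_lists_length_eq card_lists_length_eq)
  obtain Y where Y: "Y \<subseteq> X" "card Y = n" "finite Y"
    using obtain_subset_with_card_n[of n X] assms(2) cardX by auto
  define edge where "edge x = pos r m ps x ` {..<r}" for x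
  have mono: "strict_mono_on {..<r} (pos r m ps x)" if "x \<in> X" for x
    using pos_strict_mono that unfolding X_def .
  have edge: "finite (edge x)" "card (edge x) = r" if "x \<in> X" for x
    unfolding edge_def using strict_mono_on_imp_inj_on[OF mono[OF that]] by (simp_all add: card_image)
  have vtx: "vtx (edge x) i = pos r m ps x i" if "x \<in> X" "i < r" for x i
    unfolding edge_def using vtx_of_increasing[OF mono[OF that(1)] that(2)] .
  have disj: "x = y" if "x \<in> X" "y \<in> X" "v \<in> edge x" "v \<in> edge y" for x y v
    using that pos_inj unfolding edge_def X_def by auto
  have inj: "inj_on edge X"
  proof (rule inj_onI)
    fix x y assume xy: "x \<in> X" "y \<in> X" "edge x = edge y"
    have "pos r m ps x 0 \<in> edge x" using assms(1) unfolding edge_def by simp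
    then show "x = y" using disj xy by metis
  qed
  let ?E = "edge ` Y"
  let ?M = "(\<Union>?E, ?E)"
  have "matching r ?M"
    unfolding matching_def hypergraph_def verts_def edges_def fst_conv snd_conv
  proof (intro conjI ballI)
    show "finite (\<Union>?E)" using Y(1,3) edge(1) by auto
    show "e \<subseteq> \<Union>?E" if "e \<in> ?E" for e using that by blast
    show "card e = r" if "e \<in> ?E" for e using that edge(2) Y(1) by auto
    fix v assume "v \<in> \<Union>?E"
    then obtain x where x: "x \<in> Y" "v \<in> edge x" by blast
    have "e = edge x" if "e \<in> ?E" "v \<in> e" for e
    proof -
      obtain y where y: "y \<in> Y" "e = edge y" using \<open>e \<in> ?E\<close> by blast
      then show ?thesis using disj[of y x v] x Y(1) \<open>v \<in> e\<close> by auto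
    qed
    then show "\<exists>!e. e \<in> ?E \<and> v \<in> e" using x by (intro ex1I[of _ "edge x"]) auto
  qed
  moreover have "msize ?M = n"
    unfolding msize_def edges_def using card_image[OF inj_on_subset[OF inj Y(1)]] Y by simp
  moreover have "L_matching r ?M \<le> m"
  proof (rule L_matching_bounds(2))
    fix P C assume P: "is_pattern r P" and C: "C \<subseteq> edges ?M" "is_clique P (\<Union>C, C)"
    obtain A B where AB: "P = (A \<union> B, {A, B})" "A \<noteq> B" using pattern_pair[OF P] by metis
    obtain Z where Z: "Z \<subseteq> Y" "C = edge ` Z" using C(1) by (auto simp: edges_def subset_image_iff)
    have ZX: "Z \<subseteq> X" using Z Y by blast
    \<comment> \<open>The initial block is never reversed, so the orientation of \<open>P\<close> that matters is the one in
      which the first vertex of the first edge is the smallest of all.\<close>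
    define T where "T = (\<lambda>i j. if vtx A 0 < vtx B 0 then vtx A i < vtx B j else vtx B i < vtx A j)"
    have type: "prefix_type (ps ! l) i j \<longleftrightarrow> T i j"
      if xy: "x \<in> Z" "y \<in> Z" and l: "l < length ps" "take l x = take l y" "x ! l < y ! l"
        and ij: "i < r" "j < r" for x y l i j
    proof -
      have X: "x \<in> X" "y \<in> X" using xy ZX by auto
      have pt: "has_type r (prefix_type (ps ! l)) (edge x) (edge y)"
        unfolding has_type_def
        using vtx X pos_less_iff[OF ps(2) X[unfolded X_def] l] by simp
      have "ps ! l \<in> (SIGMA k:{..<r}. Pow {1..k})" using l(1) ps(3) nth_mem by metis
      then have "prefix_type (ps ! l) 0 0" by (auto simp: prefix_type_def block_type_def)
      then have 0: "vtx (edge x) 0 < vtx (edge y) 0" using pt assms(1) unfolding has_type_def by blast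
      have "edge x \<noteq> edge y" using 0 by auto
      moreover have "edge x \<in> C" "edge y \<in> C" using xy Z(2) by auto
      ultimately have "order_isomorphic (edge x \<union> edge y, {edge x, edge y}) P"
        using C(2) unfolding is_clique_def edges_def snd_conv by blast
      then have iso: "order_isomorphic (edge x \<union> edge y, {edge x, edge y}) (A \<union> B, {A, B})"
        unfolding AB(1) .
      have "has_type r T (edge x) (edge y)"
        using iso_pair_types[OF iso AB(2) edge(1)[OF X(1)] edge(1)[OF X(2)] edge(2)[OF X(1)] edge(2)[OF X(2)]]
      proof
        assume AB': "has_type r (\<lambda>i j. vtx A i < vtx B j) (edge x) (edge y)"
        then have "vtx A 0 < vtx B 0" using 0 assms(1) unfolding has_type_def by blast
        then show ?thesis using AB' unfolding T_def by simp
      next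
        assume BA: "has_type r (\<lambda>i j. vtx B i < vtx A j) (edge x) (edge y)"
        then have "vtx B 0 < vtx A 0" using 0 assms(1) unfolding has_type_def by blast
        then have "\<not> vtx A 0 < vtx B 0" by simp
        then show ?thesis using BA unfolding T_def by simp
      qed
      then show ?thesis using pt ij unfolding has_type_def by blast
    qed
    have unique: "l = l'"
      if "x \<in> Z" "y \<in> Z" "l < length ps" "take l x = take l y" "x ! l \<noteq> y ! l"
        "x' \<in> Z" "y' \<in> Z" "l' < length ps" "take l' x' = take l' y'" "x' ! l' \<noteq> y' ! l'"
      for x y l x' y' l'
    proof -
      have T: "prefix_type (ps ! l) i j \<longleftrightarrow> T i j"
        if "x \<in> Z" "y \<in> Z" "l < length ps" "take l x = take l y" "x ! l \<noteq> y ! l" "i < r" "j < r"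
        for x y l i j
        using that(5)
      proof (rule linorder_neqE_nat)
        assume "x ! l < y ! l"
        then show ?thesis using type that(1-4,6,7) by simp
      next
        assume "y ! l < x ! l"
        then show ?thesis using type that(1-3,6,7) that(4)[symmetric] by simp
      qed
      have "ps ! l = ps ! l'"
        by (rule prefix_type_inj[of _ r])
          (use ps(3) nth_mem[of l ps] nth_mem[of l' ps] T[of x y l] T[of x' y' l'] that in \<open>simp_all\<close>)
      then show ?thesis using ps(1) that by (simp add: nth_eq_iff_index_eq)
    qed
    have diff: "\<exists>l<length ps. take l x = take l y \<and> x ! l \<noteq> y ! l" if "x \<in> Z" "y \<in> Z" "x \<noteq> y" for x y
    proof -
      have "x \<in> X" "y \<in> X" using that ZX by auto
      then have "length x = length ps" "length y = length ps" unfolding X_def labels_def by auto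
      then show ?thesis using first_difference[of x y] \<open>x \<noteq> y\<close> by simp
    qed
    have "\<exists>l<length ps. inj_on (\<lambda>x. x ! l) Z"
    proof (cases "\<exists>x\<in>Z. \<exists>y\<in>Z. x \<noteq> y")
      case True
      then obtain x y where xy: "x \<in> Z" "y \<in> Z" "x \<noteq> y" by blast
      then obtain l where l: "l < length ps" "take l x = take l y" "x ! l \<noteq> y ! l" using diff by blast
      have "x' ! l \<noteq> y' ! l" if "x' \<in> Z" "y' \<in> Z" "x' \<noteq> y'" for x' y'
        using diff[OF that] unique[OF xy(1,2) l that(1,2)] by blast
      then show ?thesis using l(1) unfolding inj_on_def by blast
    next
      case False
      have "(2::nat) ^ 1 \<le> 2 ^ r" using assms(1) by (intro power_increasing) auto
      then have "0 < length ps" using ps(4) by simp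
      then show ?thesis using False unfolding inj_on_def by blast
    qed
    then obtain l where l: "l < length ps" "inj_on (\<lambda>x. x ! l) Z" by blast
    have "(\<lambda>x. x ! l) ` Z \<subseteq> {..<m}"
    proof
      fix t assume "t \<in> (\<lambda>x. x ! l) ` Z"
      then obtain x where "x \<in> X" "t = x ! l" using ZX by blast
      then show "t \<in> {..<m}"
        using l(1) nth_mem[of l x] unfolding X_def labels_def by (auto simp: subset_iff)
    qed
    then have "card Z \<le> card {..<m}" using l(2) by (intro card_inj_on_le) auto
    moreover have "card C \<le> card Z"
      unfolding Z(2) using Z(1) Y(3) by (intro card_image_le) (rule finite_subset)
    ultimately show "card C \<le> m" by simp
  qed (use assms(1) Y(3) in \<open>auto simp: edges_def\<close>)
  ultimately show ?thesis by blast
qed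

section \<open>Bounds on the minimum\<close>

lemma L_lower:
  assumes "0 < r"
  shows "n \<le> 2 ^ (r - 1) * fact (r - 1) * L r n ^ (2 ^ r - 1)"
proof -
  let ?A = "{L_matching r M | M :: nat ordered_hypergraph. matching r M \<and> msize M = n}"
  have "(2::nat) ^ 1 \<le> 2 ^ r" using assms by (intro power_increasing) auto
  \<comment> \<open>The minimum ranges over a nonempty set: with \<open>m = n\<close> the construction yields a matching.\<close>
  then have "n \<le> n ^ (2 ^ r - 1)" by (cases "n = 0") (auto intro: self_le_power)
  then have "?A \<noteq> {}" using matching_without_large_clique[OF assms, of n n] by blast
  then have "L r n \<in> ?A" unfolding L_def by (rule Inf_nat_def1)
  then show ?thesis using matching_size_le[OF _ assms] by auto
qed

lemma L_upper:
  assumes "0 < r" "n \<le> m ^ (2 ^ r - 1)"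
  shows "L r n \<le> m"
proof -
  obtain M :: "nat ordered_hypergraph" where M: "matching r M" "msize M = n" "L_matching r M \<le> m"
    using matching_without_large_clique[OF assms] by blast
  have "L r n \<le> L_matching r M" unfolding L_def by (rule cInf_lower) (use M(1,2) in blast, simp)
  then show ?thesis using M by simp
qed

lemma L_root_bounds:
  fixes c :: nat
  assumes "0 < r" "0 < n" "2 ^ (r - 1) * fact (r - 1) \<le> c ^ (2 ^ r - 1)"
  defines "\<rho> \<equiv> real n powr (1 / real (2 ^ r - 1))"
  shows "\<rho> \<le> real c * real (L r n)" and "int (L r n) \<le> \<lceil>\<rho>\<rceil>"
proof -
  define d :: nat where "d = 2 ^ r - 1"
  have "(2::nat) ^ 1 \<le> 2 ^ r" using assms(1) by (intro power_increasing) auto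
  then have d: "0 < d" unfolding d_def by simp
  have \<rho>: "\<rho> ^ d = real n" "0 \<le> \<rho>"
    unfolding \<rho>_def d_def[symmetric] using d assms(2) by (simp_all add: powr_power)
  have "n \<le> 2 ^ (r - 1) * fact (r - 1) * L r n ^ d" unfolding d_def by (rule L_lower[OF assms(1)])
  also have "\<dots> \<le> c ^ d * L r n ^ d" using assms(3) unfolding d_def by (rule mult_le_mono1)
  finally have "real n \<le> real ((c * L r n) ^ d)" by (simp only: power_mult_distrib of_nat_le_iff)
  then have "\<rho> ^ d \<le> (real c * real (L r n)) ^ d" unfolding \<rho>(1) by simp
  then show "\<rho> \<le> real c * real (L r n)" using \<rho>(2) d by (simp add: power_mono_iff)
  have "real n \<le> real (nat \<lceil>\<rho>\<rceil>) ^ d"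
    unfolding \<rho>(1)[symmetric] using \<rho>(2) by (intro power_mono) auto
  then have "n \<le> nat \<lceil>\<rho>\<rceil> ^ (2 ^ r - 1)"
    unfolding d_def[symmetric] by (simp flip: of_nat_power)
  then have "L r n \<le> nat \<lceil>\<rho>\<rceil>" by (rule L_upper[OF assms(1)])
  moreover have "0 \<le> \<lceil>\<rho>\<rceil>" using \<rho>(2) by simp
  ultimately show "int (L r n) \<le> \<lceil>\<rho>\<rceil>" by (simp only: le_nat_iff)
qed

theorem theorem1p8:
  fixes n :: nat
  assumes "n \<ge> 1"
  shows "1 / 2 * real n powr (1 / 7) \<le> real (L 3 n) \<and>
         int (L 3 n) \<le> \<lceil>real n powr (1 / 7)\<rceil> \<and>
         1 / 4 * real n powr (1 / 15) \<le> real (L 4 n) \<and>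
         int (L 4 n) \<le> \<lceil>real n powr (1 / 15)\<rceil>"
proof -
  \<comment> \<open>\<open>2\<^sup>2 \<cdot> 2! = 8 \<le> 2\<^sup>7\<close> and \<open>2\<^sup>3 \<cdot> 3! = 48 \<le> 4\<^sup>1\<^sup>5\<close>\<close>
  have "(2::nat) ^ (3 - 1) * fact (3 - 1) \<le> 2 ^ (2 ^ 3 - 1)"
    "(2::nat) ^ (4 - 1) * fact (4 - 1) \<le> 4 ^ (2 ^ 4 - 1)" by (simp_all add: fact_numeral)
  then show ?thesis
    using L_root_bounds[of 3 n 2] L_root_bounds[of 4 n 4] assms by simp
qed

end
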